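(* If $G$ is an almost opposable finite simple graph, then the first player wins SNORT on $G$.
   Context: All graphs are finite and simple. $N[v]$ denotes the closed neighbourhood of $v$. An opposition of a graph $G$ is an automorphism $f$ of $G$ of order two, in the sense $f\circ f=\mathrm{id}$, such that $f(v)\notin N[v]$ for all $v\in V(G)$. A graph is opposable if it has an opposition (the empty graph is vacuously opposable). A set $S\subseteq V(G)$ is admissible if $u\in S\subseteq N[u]$ for some $u\in V(G)$. The graph $G$ is almost opposable if there is an admissible set $S$ such that $G-S$ is opposable. SNORT on a graph $G$: two players, Left and Right, move alternately; all vertices start uncoloured. On her turn Left colours an uncoloured vertex blue that is not adjacent to any red vertex; on his turn Right colours an uncoloured vertex red that is not adjacent to any blue vertex. A player unable to move on their turn loses. "The first player wins SNORT on $G$" means that the player who moves first has a winning strategy (whether that player is Left or Right). *)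

theory Defs
  imports "Graph_Theory.Digraph_Isomorphism"
begin

text \<open>
  Finite simple graphs are the symmetric, loop-free digraphs without parallel arcs of the
  locale \<^locale>\<open>graph\<close>; adjacency of \<open>u\<close> and \<open>v\<close> is \<open>u \<rightarrow>\<^bsub>G\<^esub> v\<close>.
\<close>

definition closed_nbhd :: "('a, 'b) pre_digraph \<Rightarrow> 'a \<Rightarrow> 'a set" where
  "closed_nbhd G v = insert v {w \<in> verts G. v \<rightarrow>\<^bsub>G\<^esub> w}"

definition automorphism :: "('a, 'b) pre_digraph \<Rightarrow> ('a \<Rightarrow> 'a) \<Rightarrow> bool" where
  "automorphism G f \<longleftrightarrow> bij_betw f (verts G) (verts G) \<and>
     (\<forall>u \<in> verts G. \<forall>v \<in> verts G. f u \<rightarrow>\<^bsub>G\<^esub> f v \<longleftrightarrow> u \<rightarrow>\<^bsub>G\<^esub> v)"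

definition opposition :: "('a, 'b) pre_digraph \<Rightarrow> ('a \<Rightarrow> 'a) \<Rightarrow> bool" where
  "opposition G f \<longleftrightarrow> automorphism G f \<and> (\<forall>v \<in> verts G. f (f v) = v) \<and>
     (\<forall>v \<in> verts G. f v \<notin> closed_nbhd G v)"

definition opposable :: "('a, 'b) pre_digraph \<Rightarrow> bool" where
  "opposable G \<longleftrightarrow> (\<exists>f. opposition G f)"

definition admissible :: "('a, 'b) pre_digraph \<Rightarrow> 'a set \<Rightarrow> bool" where
  "admissible G S \<longleftrightarrow> S \<subseteq> verts G \<and> (\<exists>u \<in> verts G. u \<in> S \<and> S \<subseteq> closed_nbhd G u)"

definition almost_opposable :: "('a, 'b) pre_digraph \<Rightarrow> bool" where
  "almost_opposable G \<longleftrightarrow> (\<exists>S. admissible G S \<and> opposable (G \<restriction> (verts G - S)))"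

text \<open>
  A colour is identified with the player using it: \<open>Some Left\<close> is blue, \<open>Some Right\<close> is red,
  and \<open>None\<close> means uncoloured.
\<close>

datatype player = Left | Right

fun opponent :: "player \<Rightarrow> player" where
  "opponent Left = Right"
| "opponent Right = Left"

type_synonym 'a position = "'a \<Rightarrow> player option"

definition legal :: "('a, 'b) pre_digraph \<Rightarrow> player \<Rightarrow> 'a position \<Rightarrow> 'a \<Rightarrow> bool" where
  "legal G p c v \<longleftrightarrow> v \<in> verts G \<and> c v = None \<and>
     (\<forall>w \<in> verts G. v \<rightarrow>\<^bsub>G\<^esub> w \<longrightarrow> c w \<noteq> Some (opponent p))"

definition can_move :: "('a, 'b) pre_digraph \<Rightarrow> player \<Rightarrow> 'a position \<Rightarrow> bool" where
  "can_move G p c \<longleftrightarrow> (\<exists>v. legal G p c v)"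

definition strategy :: "('a, 'b) pre_digraph \<Rightarrow> player \<Rightarrow> ('a position \<Rightarrow> 'a) \<Rightarrow> bool" where
  "strategy G p \<sigma> \<longleftrightarrow> (\<forall>c. can_move G p c \<longrightarrow> legal G p c (\<sigma> c))"

text \<open>
  \<open>reached G s p \<sigma> q c\<close>: some course of play started by \<open>s\<close> from the uncoloured graph, in which
  \<open>p\<close> follows \<open>\<sigma>\<close> and the opponent moves arbitrarily, arrives at position \<open>c\<close> with \<open>q\<close> to move.
\<close>

inductive reached ::
  "('a, 'b) pre_digraph \<Rightarrow> player \<Rightarrow> player \<Rightarrow> ('a position \<Rightarrow> 'a) \<Rightarrow> player \<Rightarrow> 'a position \<Rightarrow> bool"
  for G :: "('a, 'b) pre_digraph" and s p :: player and \<sigma> :: "'a position \<Rightarrow> 'a"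
where
  start: "reached G s p \<sigma> s (\<lambda>_. None)"
| own_move: "reached G s p \<sigma> p c \<Longrightarrow> legal G p c (\<sigma> c)
    \<Longrightarrow> reached G s p \<sigma> (opponent p) (c(\<sigma> c := Some p))"
| opponent_move: "reached G s p \<sigma> (opponent p) c \<Longrightarrow> legal G (opponent p) c v
    \<Longrightarrow> reached G s p \<sigma> p (c(v := Some (opponent p)))"

text \<open>
  A player to move without a legal move loses. Every move colours a further vertex, so on a
  finite graph every play ends, and \<open>p\<close> wins all plays following \<open>\<sigma>\<close> iff each of them ends with
  the opponent unable to move.
\<close>

definition winning_strategy ::
  "('a, 'b) pre_digraph \<Rightarrow> player \<Rightarrow> player \<Rightarrow> ('a position \<Rightarrow> 'a) \<Rightarrow> bool" where
  "winning_strategy G s p \<sigma> \<longleftrightarrow> strategy G p \<sigma> \<and>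
     (\<forall>q c. reached G s p \<sigma> q c \<and> \<not> can_move G q c \<longrightarrow> q = opponent p)"

definition first_player_wins :: "('a, 'b) pre_digraph \<Rightarrow> bool" where
  "first_player_wins G \<longleftrightarrow> (\<forall>p. \<exists>\<sigma>. winning_strategy G p p \<sigma>)"

text \<open>For graphs, automorphisms are the vertex parts of the library's digraph automorphisms.\<close>

lemma automorphism_iff_digraph_isomorphism:
  assumes "graph G"
  shows "automorphism G f \<longleftrightarrow>
    (\<exists>h. pre_digraph.digraph_isomorphism G h \<and> app_iso h G = G \<and> iso_verts h = f)"
proof
  interpret graph G by fact
  assume a: "automorphism G f"
  define g where "g e = (SOME e'. e' \<in> arcs G \<and> tail G e' = f (tail G e) \<and> head G e' = f (head G e))" for e
  have g: "g e \<in> arcs G \<and> tail G (g e) = f (tail G e) \<and> head G (g e) = f (head G e)"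
    if "e \<in> arcs G" for e
  proof -
    have "tail G e \<rightarrow>\<^bsub>G\<^esub> head G e"
      using that by (auto simp: arcs_ends_def arc_to_ends_def)
    then have "f (tail G e) \<rightarrow>\<^bsub>G\<^esub> f (head G e)"
      using a that by (auto simp: automorphism_def)
    then have "\<exists>e'. e' \<in> arcs G \<and> tail G e' = f (tail G e) \<and> head G e' = f (head G e)"
      by (auto simp: arcs_ends_def arc_to_ends_def)
    then show ?thesis unfolding g_def by (rule someI_ex)
  qed
  have f: "inj_on f (verts G)" "f ` verts G = verts G"
    using a by (auto simp: automorphism_def bij_betw_def)
  have inj: "inj_on g (arcs G)"
  proof (rule inj_onI)
    fix x y assume xy: "x \<in> arcs G" "y \<in> arcs G" "g x = g y"
    then have "f (tail G x) = f (tail G y)" "f (head G x) = f (head G y)"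
      using g by metis+
    then have "arc_to_ends G x = arc_to_ends G y"
      using xy f(1) by (auto simp: arc_to_ends_def dest: inj_onD)
    then show "x = y" using xy no_multi_arcs by blast
  qed
  have im: "g ` arcs G = arcs G"
    using endo_inj_surj[OF finite_arcs _ inj] g by blast
  let ?h = "\<lparr>iso_verts = f, iso_arcs = g, iso_head = head G, iso_tail = tail G\<rparr>"
  have "digraph_isomorphism ?h" "app_iso ?h G = G"
    using f inj im g wf_digraph by (auto simp: digraph_isomorphism_def app_iso_def)
  then show "\<exists>h. digraph_isomorphism h \<and> app_iso h G = G \<and> iso_verts h = f"
    by (intro exI[of _ ?h]) simp
next
  interpret graph G by fact
  assume "\<exists>h. digraph_isomorphism h \<and> app_iso h G = G \<and> iso_verts h = f"
  then obtain h where h: "digraph_isomorphism h" "app_iso h G = G" "iso_verts h = f"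
    by blast
  have f: "inj_on f (verts G)" "f ` verts G = verts G"
    using h by (auto simp: digraph_isomorphism_def) (metis imageI verts_app_iso, metis verts_app_iso)
  have eq: "iso_tail h = tail G" "iso_head h = head G" "iso_arcs h ` arcs G = arcs G"
    using h(2) by (metis tail_app_iso, metis head_app_iso, metis arcs_app_iso)
  have *: "arc_to_ends G (iso_arcs h e) = (f (tail G e), f (head G e))" if "e \<in> arcs G" for e
    using that h eq by (auto simp: digraph_isomorphism_def arc_to_ends_def)
  have "f u \<rightarrow>\<^bsub>G\<^esub> f v \<longleftrightarrow> u \<rightarrow>\<^bsub>G\<^esub> v" if uv: "u \<in> verts G" "v \<in> verts G" for u v
  proof
    assume "f u \<rightarrow>\<^bsub>G\<^esub> f v"
    then obtain e' where e': "e' \<in> arcs G" "arc_to_ends G e' = (f u, f v)"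
      by (auto simp: arcs_ends_def)
    then obtain e where e: "e \<in> arcs G" "e' = iso_arcs h e"
      using eq(3) by blast
    then have "f (tail G e) = f u" "f (head G e) = f v"
      using * e' by auto
    then have "tail G e = u" "head G e = v"
      using f(1) uv e by (auto dest: inj_onD)
    then show "u \<rightarrow>\<^bsub>G\<^esub> v" using e by (auto simp: arcs_ends_def arc_to_ends_def)
  next
    assume "u \<rightarrow>\<^bsub>G\<^esub> v"
    then obtain e where e: "e \<in> arcs G" "tail G e = u" "head G e = v"
      by (auto simp: arcs_ends_def arc_to_ends_def)
    then have "iso_arcs h e \<in> arcs G" "arc_to_ends G (iso_arcs h e) = (f u, f v)"
      using * eq(3) by auto
    then show "f u \<rightarrow>\<^bsub>G\<^esub> f v" unfolding arcs_ends_def by (metis imageI)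
  qed
  then show "automorphism G f" using f by (auto simp: automorphism_def bij_betw_def)
qed

end

theory Submission
  imports Defs
begin

text \<open>
  The first player colours the centre \<open>u\<close> of an admissible set \<open>S\<close>, which bars the opponent from
  \<open>S\<close> for the rest of the game. From then on every move \<open>v\<close> of the opponent lies outside \<open>S\<close> and
  is answered by \<open>f v\<close>, where \<open>f\<close> is an opposition of \<open>G - S\<close>. The colouring of \<open>G - S\<close> is thus
  kept antisymmetric under \<open>f\<close>, so the reply is legal: a neighbour of \<open>f v\<close> in the opponent's
  colour would be \<open>v\<close> itself or the mirror image of a neighbour of \<open>v\<close> in the first player's colour.
\<close>

lemma dominates_induce_subgraph:
  "x \<rightarrow>\<^bsub>G \<restriction> W\<^esub> y \<longleftrightarrow> x \<in> W \<and> y \<in> W \<and> x \<rightarrow>\<^bsub>G\<^esub> y"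
  by (auto simp: arcs_ends_def arc_to_ends_def induce_subgraph_def)

lemma opposition_induce_subgraph_iff:
  "opposition (G \<restriction> W) f \<longleftrightarrow> bij_betw f W W \<and>
     (\<forall>x \<in> W. \<forall>y \<in> W. f x \<rightarrow>\<^bsub>G\<^esub> f y \<longleftrightarrow> x \<rightarrow>\<^bsub>G\<^esub> y) \<and>
     (\<forall>x \<in> W. f (f x) = x \<and> f x \<noteq> x \<and> \<not> x \<rightarrow>\<^bsub>G\<^esub> f x)"
  by (auto simp: opposition_def automorphism_def closed_nbhd_def dominates_induce_subgraph
      dest: bij_betwE)

lemma opponent_opponent [simp]: "opponent (opponent p) = p"
  by (cases p) auto

lemma opponent_neq [simp]: "opponent p \<noteq> p" "p \<noteq> opponent p"
  by (cases p; simp)+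

text \<open>The invariant for positions with the opponent to move. As
  \<open>map_option opponent\<close> fixes \<open>None\<close>, antisymmetry also makes
  \<open>v\<close> and \<open>f v\<close> uncoloured together.\<close>

definition mirrored ::
  "('a, 'b) pre_digraph \<Rightarrow> 'a set \<Rightarrow> 'a \<Rightarrow> ('a \<Rightarrow> 'a) \<Rightarrow> player \<Rightarrow> 'a position \<Rightarrow> bool" where
  "mirrored G S u f p c \<longleftrightarrow> c u = Some p \<and> (\<forall>w \<in> S. c w \<noteq> Some (opponent p)) \<and>
     (\<forall>v \<in> verts G - S. c (f v) = map_option opponent (c v))"

text \<open>A strategy sees only the position, not the history, so the opponent's last move has to
  be recovered from the colouring.\<close>

definition unanswered ::
  "('a, 'b) pre_digraph \<Rightarrow> 'a set \<Rightarrow> ('a \<Rightarrow> 'a) \<Rightarrow> player \<Rightarrow> 'a position \<Rightarrow> 'a \<Rightarrow> bool" where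
  "unanswered G S f p c v \<longleftrightarrow> v \<in> verts G - S \<and> c v = Some (opponent p) \<and> c (f v) = None"

text \<open>The legality test and the final default branch serve positions that never arise in play:
  \<open>strategy\<close> demands a legal move wherever one exists.\<close>

definition mirror_strategy ::
  "('a, 'b) pre_digraph \<Rightarrow> 'a set \<Rightarrow> 'a \<Rightarrow> ('a \<Rightarrow> 'a) \<Rightarrow> player \<Rightarrow> 'a position \<Rightarrow> 'a" where
  "mirror_strategy G S u f p c =
    (if c = (\<lambda>_. None) then u
     else if \<exists>v. unanswered G S f p c v \<and> legal G p c (f v)
     then f (SOME v. unanswered G S f p c v \<and> legal G p c (f v))
     else (SOME v. legal G p c v))"

locale almost_opposition = graph G for G :: "('a, 'b) pre_digraph" +
  fixes S :: "'a set" and u :: 'a and f :: "'a \<Rightarrow> 'a"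
  assumes centre: "u \<in> S" "S \<subseteq> closed_nbhd G u" "S \<subseteq> verts G"
    and opposition: "opposition (G \<restriction> (verts G - S)) f"
begin

lemma f_outside: "f v \<in> verts G - S" if "v \<in> verts G - S"
  using opposition bij_betwE[of f] that unfolding opposition_induce_subgraph_iff by blast

lemma f_involution: "f (f v) = v" if "v \<in> verts G - S"
  using opposition that unfolding opposition_induce_subgraph_iff by blast

lemma f_neq: "f v \<noteq> v" if "v \<in> verts G - S"
  using opposition that unfolding opposition_induce_subgraph_iff by blast

lemma not_dominates_f: "\<not> v \<rightarrow>\<^bsub>G\<^esub> f v" if "v \<in> verts G - S"
  using opposition that unfolding opposition_induce_subgraph_iff by blast

text \<open>Apply the automorphism to the pair \<open>v\<close>, \<open>f w\<close> and use that
  \<open>f\<close> is an involution.\<close>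

lemma f_dominates_iff: "f v \<rightarrow>\<^bsub>G\<^esub> w \<longleftrightarrow> v \<rightarrow>\<^bsub>G\<^esub> f w"
  if "v \<in> verts G - S" "w \<in> verts G - S"
  using opposition that f_outside[of w] f_involution[of w]
  unfolding opposition_induce_subgraph_iff by metis

lemma opponent_move_outside:
  assumes "mirrored G S u f p c" "legal G (opponent p) c v"
  shows "v \<in> verts G - S"
proof -
  have "v \<notin> S"
  proof
    assume "v \<in> S"
    moreover have "v \<noteq> u" using assms by (auto simp: mirrored_def legal_def)
    ultimately have "u \<rightarrow>\<^bsub>G\<^esub> v" using centre by (auto simp: closed_nbhd_def)
    then have "v \<rightarrow>\<^bsub>G\<^esub> u" by (rule graph_symmetric)
    then show False using assms centre by (auto simp: mirrored_def legal_def)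
  qed
  then show ?thesis using assms by (simp add: legal_def)
qed

lemma legal_reply:
  assumes m: "mirrored G S u f p c" and l: "legal G (opponent p) c v"
  shows "legal G p (c(v := Some (opponent p))) (f v)"
proof -
  have v: "v \<in> verts G - S" using opponent_move_outside[OF m l] .
  have "(c(v := Some (opponent p))) w \<noteq> Some (opponent p)"
    if w: "w \<in> verts G" "f v \<rightarrow>\<^bsub>G\<^esub> w" for w
  proof (cases "w \<in> S")
    case True
    then show ?thesis using m v by (auto simp: mirrored_def)
  next
    case False
    then have w': "w \<in> verts G - S" using w by simp
    have vfw: "v \<rightarrow>\<^bsub>G\<^esub> f w" using w f_dominates_iff[OF v w'] by simp
    have "w \<noteq> v" using vfw not_dominates_f[OF v] by blast
    \<comment> \<open>Legality of \<open>v\<close> forbids the colour of \<open>p\<close> on its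
      neighbour \<open>f w\<close>; antisymmetry then keeps the opponent's colour off
      \<open>w\<close>.\<close>
    moreover have "c (f w) \<noteq> Some p"
      using l vfw f_outside[OF w'] by (auto simp: legal_def)
    ultimately show ?thesis using m w' by (auto simp: mirrored_def)
  qed
  moreover have "c (f v) = None" using m l v by (auto simp: mirrored_def legal_def)
  ultimately show ?thesis using f_outside[OF v] f_neq[OF v] by (simp add: legal_def)
qed

text \<open>In a mirrored position every opponent vertex outside \<open>S\<close> has its image
  coloured for \<open>p\<close>, so only the new move can lack an answer.\<close>

lemma unanswered_iff:
  assumes m: "mirrored G S u f p c" and l: "legal G (opponent p) c v"
  shows "unanswered G S f p (c(v := Some (opponent p))) w \<longleftrightarrow> w = v"
proof
  assume "unanswered G S f p (c(v := Some (opponent p))) w"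
  then show "w = v" using m by (auto simp: unanswered_def mirrored_def split: if_splits)
next
  have v: "v \<in> verts G - S" using opponent_move_outside[OF m l] .
  assume "w = v"
  then show "unanswered G S f p (c(v := Some (opponent p))) w"
    using legal_reply[OF m l] v f_neq[OF v] by (simp add: unanswered_def legal_def)
qed

lemma mirror_strategy_reply:
  assumes m: "mirrored G S u f p c" and l: "legal G (opponent p) c v"
  shows "mirror_strategy G S u f p (c(v := Some (opponent p))) = f v"
proof -
  have "c(v := Some (opponent p)) \<noteq> (\<lambda>_. None)"
    by (metis fun_upd_same option.distinct(1))
  then show ?thesis
    using legal_reply[OF m l]
    \<comment> \<open>Both choices range over the single candidate \<open>v\<close>;
      \<open>conj_cong\<close> lets \<open>w = v\<close> rewrite the legality conjunct.\<close>
    by (simp add: mirror_strategy_def unanswered_iff[OF m l] cong: conj_cong)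
qed

lemma mirrored_reply:
  assumes m: "mirrored G S u f p c" and l: "legal G (opponent p) c v"
  shows "mirrored G S u f p (c(v := Some (opponent p), f v := Some p))"
proof -
  have v: "v \<in> verts G - S" using opponent_move_outside[OF m l] .
  have fv: "f v \<in> verts G - S" using f_outside[OF v] .
  have "(c(v := Some (opponent p), f v := Some p)) (f w) =
      map_option opponent ((c(v := Some (opponent p), f v := Some p)) w)"
    if w: "w \<in> verts G - S" for w
  proof -
    consider "w = v" | "w = f v" | "w \<noteq> v" "w \<noteq> f v" by blast
    then show ?thesis
    proof cases
      case 3
      \<comment> \<open>Neither \<open>w\<close> nor \<open>f w\<close> is touched by the two
        updates, so the old antisymmetry carries over.\<close>
      then have "f w \<noteq> f v" "f w \<noteq> v"
        using f_involution[OF v] f_involution[OF w] by metis+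
      then show ?thesis using 3 m w by (auto simp: mirrored_def)
    qed (use f_involution[OF v] f_neq[OF v] in auto)
  qed
  then show ?thesis using m v fv centre by (auto simp: mirrored_def)
qed

lemma strategy_mirror_strategy: "strategy G p (mirror_strategy G S u f p)"
  unfolding strategy_def
proof (intro allI impI)
  fix c assume "can_move G p c"
  then have ex: "legal G p c (SOME v. legal G p c v)"
    unfolding can_move_def by (rule someI_ex)
  have rep: "legal G p c (f (SOME v. unanswered G S f p c v \<and> legal G p c (f v)))"
    if "\<exists>v. unanswered G S f p c v \<and> legal G p c (f v)"
    using someI_ex[OF that] by blast
  have "legal G p (\<lambda>_. None) u" using centre by (auto simp: legal_def)
  with ex rep show "legal G p c (mirror_strategy G S u f p c)"
    by (auto simp: mirror_strategy_def)
qed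

text \<open>Antisymmetry fails while a reply is pending, so on the turn of \<open>p\<close> the
  invariant refers to the mirrored position \<open>c'\<close> before the opponent's move.\<close>

lemma reached_mirror_strategy:
  assumes "reached G p p (mirror_strategy G S u f p) q c"
  shows "q = p \<and> (c = (\<lambda>_. None) \<or>
      (\<exists>c' v. mirrored G S u f p c' \<and> legal G (opponent p) c' v \<and> c = c'(v := Some (opponent p))))
    \<or> q = opponent p \<and> mirrored G S u f p c"
  using assms
proof (induction rule: reached.induct)
  case start
  then show ?case by simp
next
  case (own_move c)
  then consider "c = (\<lambda>_. None)"
    | c' v where "mirrored G S u f p c'" "legal G (opponent p) c' v" "c = c'(v := Some (opponent p))"
    using opponent_neq by metis
  then have "mirrored G S u f p (c(mirror_strategy G S u f p c := Some p))"
  proof cases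
    case 1
    \<comment> \<open>After the opening move only \<open>u\<close> is coloured, and \<open>f\<close>
      maps the complement of \<open>S\<close> into itself, so it never meets
      \<open>u\<close>.\<close>
    then show ?thesis
      using centre f_outside by (fastforce simp: mirrored_def mirror_strategy_def)
  next
    case 2
    then show ?thesis using mirror_strategy_reply mirrored_reply by simp
  qed
  then show ?case by blast
next
  case (opponent_move c v)
  then show ?case by auto
qed

lemma winning_mirror_strategy: "winning_strategy G p p (mirror_strategy G S u f p)"
  unfolding winning_strategy_def
proof (intro conjI allI impI strategy_mirror_strategy)
  fix q c
  assume a: "reached G p p (mirror_strategy G S u f p) q c \<and> \<not> can_move G q c"
  have "legal G p (\<lambda>_. None) u" using centre by (auto simp: legal_def)
  \<comment> \<open>On the turn of \<open>p\<close> a move always exists: \<open>u\<close> at the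
    start, the reply \<open>f v\<close> afterwards.\<close>
  then show "q = opponent p"
    using a reached_mirror_strategy[of p q c] legal_reply by (auto simp: can_move_def)
qed

end

theorem lemma4p2:
  fixes G :: "('a, 'b) pre_digraph"
  assumes "graph G"
    and "almost_opposable G"
  shows "first_player_wins G"
proof -
  obtain S u f where "u \<in> S" "S \<subseteq> closed_nbhd G u" "S \<subseteq> verts G"
    "opposition (G \<restriction> (verts G - S)) f"
    using assms(2) by (auto simp: almost_opposable_def admissible_def opposable_def)
  then interpret almost_opposition G S u f
    using assms(1) by (simp add: almost_opposition_def almost_opposition_axioms_def)
  show ?thesis
    unfolding first_player_wins_def using winning_mirror_strategy by blast
qed

end
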